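(* For any cyclic code $C=e_1C_1\oplus e_2C_2\oplus e_3C_3$ of length $n$ over $R$ there is a unique polynomial $g(x)$ such that $C=\langle g(x)\rangle$ and $g(x)\mid x^n-1$, where $$g(x)=\frac1r\sum_{i=1}^{r-1}v^i\bigl(g_1(x)-g_2(x)\bigr)+v^r\Bigl(\frac1r g_1(x)+\frac{r-1}{r}g_2(x)-g_3(x)\Bigr)+g_3(x)$$ and $g_1(x),g_2(x),g_3(x)$ are the generator polynomials of $C_1,C_2,C_3$ respectively. Moreover, if $g_1(x)=g_2(x)=g_3(x)$, then $g(x)=g_1(x)$.
   Context: Let $p$ be a prime, $k\ge1$ and $r>1$ integers with $\gcd(r,p)=1$, and $R_r=\mathbb{F}_{p^k}[v]/\langle v^{r+1}-v\rangle$. In $R_r$ put $e_1=\frac1r(v+v^2+\dots+v^r)$, $e_2=-\frac1r(v+\dots+v^{r-1})+\frac{r-1}{r}v^r$, $e_3=1-v^r$; these are nonzero orthogonal idempotents with sum $1$. $R$ denotes the subring $R=e_1\mathbb{F}_{p^k}\oplus e_2\mathbb{F}_{p^k}\oplus e_3\mathbb{F}_{p^k}$ of $R_r$. A cyclic code of length $n$ over a commutative ring $A$ is an $A$-submodule of $A^n$ stable under $(c_0,\dots,c_{n-1})\mapsto(c_{n-1},c_0,\dots,c_{n-2})$; identifying $(c_0,\dots,c_{n-1})$ with $\sum c_ix^i$, cyclic codes are the ideals of $A[x]/(x^n-1)$, and $\langle g(x)\rangle$ denotes the ideal generated in $R[x]/(x^n-1)$. For a linear code $C$ over $R$, the associated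 codes are $C_1=\{s\in\mathbb{F}_{p^k}^n : \exists\, t,u\in\mathbb{F}_{p^k}^n,\ e_1s+e_2t+e_3u\in C\}$, $C_2=\{t\in\mathbb{F}_{p^k}^n : \exists\, s,u\in\mathbb{F}_{p^k}^n,\ e_1s+e_2t+e_3u\in C\}$, $C_3=\{u\in\mathbb{F}_{p^k}^n : \exists\, s,t\in\mathbb{F}_{p^k}^n,\ e_1s+e_2t+e_3u\in C\}$, and $C=e_1C_1\oplus e_2C_2\oplus e_3C_3$; if $C$ is cyclic, so are the $C_i$. The generator polynomial of a cyclic code over $\mathbb{F}_{p^k}$ is, as usual, the monic divisor of $x^n-1$ in $\mathbb{F}_{p^k}[x]$ generating it.
   Formalization: Generators of C dividing x^n-1 are unique only up to units of R (over F_3, C=R, n=1: both 1 and 2 qualify), so uniqueness is stated for the g given by the displayed formula, together with: every other generator of C dividing x^n-1 is a unit of R times g. *)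

theory Defs
  imports "HOL-Computational_Algebra.Computational_Algebra" "HOL-Library.Cardinality"
begin

section \<open>The ring \<open>R\<^sub>r = F[v] / \<langle>v\<^sup>r\<^sup>+\<^sup>1 - v\<rangle>\<close>\<close>

text \<open>
  The parameter \<open>r\<close> is carried by the phantom type variable \<^typ>\<open>'r\<close>, via \<open>r = CARD('r)\<close>.
\<close>

definition Rr_modulus :: "nat \<Rightarrow> 'a::field poly"
  where "Rr_modulus r = monom 1 (r + 1) - monom 1 1"

quotient_type (overloaded) ('a, 'r) Rr = "'a::field poly" / "\<lambda>p q. Rr_modulus CARD('r) dvd p - q"
proof (rule equivpI)
  show "reflp (\<lambda>p q :: 'a poly. Rr_modulus CARD('r) dvd p - q)"
    by (simp add: reflp_def)
  show "symp (\<lambda>p q :: 'a poly. Rr_modulus CARD('r) dvd p - q)"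
    by (simp add: symp_def dvd_diff_commute)
  show "transp (\<lambda>p q :: 'a poly. Rr_modulus CARD('r) dvd p - q)"
  proof (rule transpI)
    fix p q s :: "'a poly"
    assume "Rr_modulus CARD('r) dvd p - q" "Rr_modulus CARD('r) dvd q - s"
    then have "Rr_modulus CARD('r) dvd (p - q) + (q - s)" by (rule dvd_add)
    then show "Rr_modulus CARD('r) dvd p - s" by simp
  qed
qed

instantiation Rr :: (field, type) comm_ring_1
begin

lift_definition zero_Rr :: "('a, 'r) Rr" is 0 .
lift_definition one_Rr :: "('a, 'r) Rr" is 1 .

lift_definition plus_Rr :: "('a, 'r) Rr \<Rightarrow> ('a, 'r) Rr \<Rightarrow> ('a, 'r) Rr" is "(+)"
proof -
  fix p p' q q' :: "'a poly"
  assume "Rr_modulus CARD('r) dvd p - p'" "Rr_modulus CARD('r) dvd q - q'"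
  then have "Rr_modulus CARD('r) dvd (p - p') + (q - q')"
    by (rule dvd_add)
  then show "Rr_modulus CARD('r) dvd (p + q) - (p' + q')"
    by (simp add: algebra_simps)
qed

lift_definition uminus_Rr :: "('a, 'r) Rr \<Rightarrow> ('a, 'r) Rr" is uminus
  by (simp add: dvd_diff_commute)

lift_definition minus_Rr :: "('a, 'r) Rr \<Rightarrow> ('a, 'r) Rr \<Rightarrow> ('a, 'r) Rr" is "(-)"
proof -
  fix p p' q q' :: "'a poly"
  assume "Rr_modulus CARD('r) dvd p - p'" "Rr_modulus CARD('r) dvd q - q'"
  then have "Rr_modulus CARD('r) dvd (p - p') - (q - q')"
    by (rule dvd_diff)
  then show "Rr_modulus CARD('r) dvd (p - q) - (p' - q')"
    by (simp add: algebra_simps)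
qed

lift_definition times_Rr :: "('a, 'r) Rr \<Rightarrow> ('a, 'r) Rr \<Rightarrow> ('a, 'r) Rr" is "(*)"
proof -
  fix p p' q q' :: "'a poly"
  assume "Rr_modulus CARD('r) dvd p - p'" "Rr_modulus CARD('r) dvd q - q'"
  then have "Rr_modulus CARD('r) dvd (p - p') * q + p' * (q - q')"
    by (intro dvd_add dvd_mult dvd_mult2)
  then show "Rr_modulus CARD('r) dvd p * q - p' * q'"
    by (simp add: algebra_simps)
qed

instance
proof
  show "(0 :: ('a, 'r) Rr) \<noteq> 1"
  proof (transfer, rule notI)
    assume "Rr_modulus CARD('r) dvd (0 - 1 :: 'a poly)"
    then have "poly (Rr_modulus CARD('r)) 0 dvd poly (0 - 1 :: 'a poly) 0"
      by (elim dvdE) simp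
    then show False
      by (simp add: Rr_modulus_def poly_monom)
  qed
qed (transfer; simp add: algebra_simps)+

end

lift_definition scal :: "'a::field \<Rightarrow> ('a, 'r) Rr" is "\<lambda>a. [:a:]" .

lift_definition vR :: "('a::field, 'r) Rr" is "[:0, 1:]" .

definition e1 :: "('a::field, 'r) Rr" where
  "e1 = scal (1 / of_nat CARD('r)) * (\<Sum>i = 1..CARD('r). vR ^ i)"

definition e2 :: "('a::field, 'r) Rr" where
  "e2 = - scal (1 / of_nat CARD('r)) * (\<Sum>i = 1..CARD('r) - 1. vR ^ i)
        + scal (of_nat (CARD('r) - 1) / of_nat CARD('r)) * vR ^ CARD('r)"

definition e3 :: "('a::field, 'r) Rr" where
  "e3 = 1 - vR ^ CARD('r)"

definition R :: "('a::field, 'r) Rr set" where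
  "R = {e1 * scal a + e2 * scal b + e3 * scal c | a b c. True}"

section \<open>Cyclic codes over a subring \<open>A\<close> of a commutative ring type\<close>

text \<open>
  A word \<open>(c\<^sub>0, \<dots>, c\<^sub>n\<^sub>-\<^sub>1)\<close> is a function on \<^typ>\<open>nat\<close> that vanishes from index \<open>n\<close> on.
\<close>

definition words :: "'b::comm_ring_1 set \<Rightarrow> nat \<Rightarrow> (nat \<Rightarrow> 'b) set" where
  "words A n = {c. (\<forall>i<n. c i \<in> A) \<and> (\<forall>i\<ge>n. c i = 0)}"

definition linear_code :: "'b::comm_ring_1 set \<Rightarrow> nat \<Rightarrow> (nat \<Rightarrow> 'b) set \<Rightarrow> bool" where
  "linear_code A n C \<longleftrightarrow>
     C \<subseteq> words A n \<and> (\<lambda>_. 0) \<in> C \<and>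
     (\<forall>c\<in>C. \<forall>d\<in>C. (\<lambda>i. c i + d i) \<in> C) \<and>
     (\<forall>a\<in>A. \<forall>c\<in>C. (\<lambda>i. a * c i) \<in> C)"

definition cyclic_shift :: "nat \<Rightarrow> (nat \<Rightarrow> 'b::zero) \<Rightarrow> nat \<Rightarrow> 'b" where
  "cyclic_shift n c = (\<lambda>i. if i < n then c ((i + n - 1) mod n) else 0)"

definition cyclic_code :: "'b::comm_ring_1 set \<Rightarrow> nat \<Rightarrow> (nat \<Rightarrow> 'b) set \<Rightarrow> bool" where
  "cyclic_code A n C \<longleftrightarrow> linear_code A n C \<and> (\<forall>c\<in>C. cyclic_shift n c \<in> C)"

definition word_poly :: "nat \<Rightarrow> (nat \<Rightarrow> 'b::comm_ring_1) \<Rightarrow> 'b poly" where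
  "word_poly n c = (\<Sum>i<n. monom (c i) i)"

definition polys_over :: "'b::comm_ring_1 set \<Rightarrow> 'b poly set" where
  "polys_over A = {f. \<forall>i. coeff f i \<in> A}"

text \<open>
  The words corresponding to the ideal generated by (the class of) \<open>g\<close> in
  \<open>A[x] / \<langle>x\<^sup>n - 1\<rangle>\<close>.
\<close>

definition generated_code :: "'b::comm_ring_1 set \<Rightarrow> nat \<Rightarrow> 'b poly \<Rightarrow> (nat \<Rightarrow> 'b) set" where
  "generated_code A n g =
     {c \<in> words A n. \<exists>f\<in>polys_over A. \<exists>h\<in>polys_over A.
        word_poly n c = f * g + h * (monom 1 n - 1)}"

text \<open>\<open>g \<in> A[x]\<close> generates \<open>C\<close> and divides \<open>x\<^sup>n - 1\<close>, the cofactor being in \<open>A[x]\<close> too.\<close>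

definition generating_divisor ::
    "'b::comm_ring_1 set \<Rightarrow> nat \<Rightarrow> (nat \<Rightarrow> 'b) set \<Rightarrow> 'b poly \<Rightarrow> bool" where
  "generating_divisor A n C g \<longleftrightarrow>
     g \<in> polys_over A \<and> C = generated_code A n g \<and>
     (\<exists>h\<in>polys_over A. monom 1 n - 1 = g * h)"

definition generator_polynomial :: "nat \<Rightarrow> (nat \<Rightarrow> 'a::field) set \<Rightarrow> 'a poly \<Rightarrow> bool" where
  "generator_polynomial n D g \<longleftrightarrow> lead_coeff g = 1 \<and> generating_divisor UNIV n D g"

section \<open>Codes over \<open>R\<close> and their components\<close>

definition combine_words ::
    "(nat \<Rightarrow> 'a::field) \<Rightarrow> (nat \<Rightarrow> 'a) \<Rightarrow> (nat \<Rightarrow> 'a) \<Rightarrow> nat \<Rightarrow> ('a, 'r) Rr" where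
  "combine_words s t u = (\<lambda>i. e1 * scal (s i) + e2 * scal (t i) + e3 * scal (u i))"

definition code1 :: "nat \<Rightarrow> (nat \<Rightarrow> ('a::field, 'r) Rr) set \<Rightarrow> (nat \<Rightarrow> 'a) set" where
  "code1 n C = {s \<in> words UNIV n. \<exists>t\<in>words UNIV n. \<exists>u\<in>words UNIV n. combine_words s t u \<in> C}"

definition code2 :: "nat \<Rightarrow> (nat \<Rightarrow> ('a::field, 'r) Rr) set \<Rightarrow> (nat \<Rightarrow> 'a) set" where
  "code2 n C = {t \<in> words UNIV n. \<exists>s\<in>words UNIV n. \<exists>u\<in>words UNIV n. combine_words s t u \<in> C}"

definition code3 :: "nat \<Rightarrow> (nat \<Rightarrow> ('a::field, 'r) Rr) set \<Rightarrow> (nat \<Rightarrow> 'a) set" where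
  "code3 n C = {u \<in> words UNIV n. \<exists>s\<in>words UNIV n. \<exists>t\<in>words UNIV n. combine_words s t u \<in> C}"

abbreviation lift_poly :: "'a::field poly \<Rightarrow> ('a, 'r) Rr poly" where
  "lift_poly \<equiv> map_poly scal"

definition combined_poly ::
    "'a::field poly \<Rightarrow> 'a poly \<Rightarrow> 'a poly \<Rightarrow> ('a, 'r) Rr poly" where
  "combined_poly g1 g2 g3 =
     smult (scal (1 / of_nat CARD('r)))
       (\<Sum>i = 1..CARD('r) - 1. smult (vR ^ i) (lift_poly g1 - lift_poly g2))
     + smult (vR ^ CARD('r))
         (smult (scal (1 / of_nat CARD('r))) (lift_poly g1)
          + smult (scal (of_nat (CARD('r) - 1) / of_nat CARD('r))) (lift_poly g2)
          - lift_poly g3)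
     + lift_poly g3"

end

(* The idempotents e1, e2, e3 make (f1, f2, f3) \<mapsto> e1 f1 + e2 f2 + e3 f3 a ring isomorphism from
   F[x]^3 onto R[x], which carries triples of cyclic codes over F to cyclic codes over R and triples
   of generating divisors of x^n - 1 to generating divisors. Existence and uniqueness up to units
   are therefore those of the generator polynomial of a cyclic code over a field. *)

theory Submission
  imports Defs
begin

section \<open>Cyclic codes over a field\<close>

text \<open>The idempotents come from v^(r+1) - v = v (v - 1) (1 + v + ... + v^(r-1)):
  \<open>e3\<close>, \<open>e1\<close>, \<open>e2\<close> are 1 modulo the first, second and third
  factor respectively and 0 modulo the other two. The factors are pairwise coprime because the third
  takes the value r at v = 1 and r is nonzero in F; this is where gcd(r, p) = 1 enters. The third
  factor is nonconstant since r > 1, so \<open>e2\<close> is not zero either. The formula for g is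
  e1 g1 + e2 g2 + e3 g3 with the powers of v collected.

  Multipliers and cofactors are taken in R[x] rather than over the larger quotient ring, and this is
  what lets them split into three polynomials over F.

  A generating divisor in R[x] is determined only up to a unit of \<open>R\<close>, that is, up to
  three independent nonzero constants. Uniqueness of g therefore concerns the divisor whose
  components are monic; a separate conjunct says that every other generating divisor is a unit
  multiple of it.\<close>

lemma polys_over_UNIV [simp]: "polys_over UNIV = UNIV"
  by (simp add: polys_over_def)

lemma coeff_word_poly: "coeff (word_poly n c) i = (if i < n then c i else 0)"
  by (simp add: word_poly_def coeff_sum)

lemma word_poly_inj:
  assumes "c \<in> words A n" "d \<in> words A n" "word_poly n c = word_poly n d"
  shows "c = d"
proof
  fix i
  show "c i = d i"
    using assms(1,2) arg_cong[OF assms(3), of "\<lambda>f. coeff f i"]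
    by (auto simp: coeff_word_poly words_def split: if_splits)
qed

text \<open>Strictness fails at n = 0, where the polynomial is 0 and has degree 0.\<close>

lemma degree_word_poly:
  assumes "n \<ge> 1"
  shows "degree (word_poly n c) < n"
  using assms by (intro le_less_trans[OF degree_le[of "n - 1"]]) (auto simp: coeff_word_poly)

lemma coeff_mod_in_words:
  fixes f :: "'a::field poly"
  assumes "degree m = n" "n \<ge> 1"
  shows "coeff (f mod m) \<in> words UNIV n"
  using degree_mod_less[of m f] assms coeff_eq_0[of "f mod m"]
  by (force simp: words_def)

lemma word_poly_coeff_mod:
  fixes f :: "'a::field poly"
  assumes "degree m = n" "n \<ge> 1"
  shows "word_poly n (coeff (f mod m)) = f mod m"
  using coeff_mod_in_words[OF assms, of f]
  by (intro poly_eqI) (auto simp: coeff_word_poly words_def)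

lemma degree_x_pow_minus_1:
  assumes "n \<ge> 1"
  shows "degree (monom 1 n - 1 :: 'a::field poly) = n"
proof (rule antisym)
  show "degree (monom 1 n - 1 :: 'a poly) \<le> n"
    by (rule degree_le) (auto simp: coeff_1)
  show "n \<le> degree (monom 1 n - 1 :: 'a poly)"
    using assms by (intro le_degree) (simp add: coeff_1)
qed

text \<open>The ideal (g, x^n - 1) collapses to (g) because g divides x^n - 1.\<close>

lemma generated_code_UNIV:
  assumes "g dvd monom 1 n - 1"
  shows "generated_code UNIV n g = {c \<in> words UNIV n. g dvd word_poly n c}"
proof -
  have "(\<exists>f h. w = f * g + h * (monom 1 n - 1)) \<longleftrightarrow> g dvd w" for w
  proof
    assume "g dvd w"
    then obtain f where "w = g * f" by (rule dvdE)
    then have "w = f * g + 0 * (monom 1 n - 1)" by simp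
    then show "\<exists>f h. w = f * g + h * (monom 1 n - 1)" by blast
  qed (use assms in auto)
  then show ?thesis by (simp add: generated_code_def)
qed

lemma generating_divisor_UNIV:
  "generating_divisor UNIV n D g \<longleftrightarrow>
     g dvd monom 1 n - 1 \<and> D = {c \<in> words UNIV n. g dvd word_poly n c}"
proof (cases "g dvd monom 1 n - 1")
  case True
  then show ?thesis
    by (auto simp: generating_divisor_def generated_code_UNIV elim!: dvdE)
next
  case False
  then show ?thesis by (auto simp: generating_divisor_def)
qed

lemma generating_divisor_dvd:
  fixes g h :: "'a::field poly"
  assumes "n \<ge> 1" "generating_divisor UNIV n D g" "generating_divisor UNIV n D h"
  shows "g dvd h"
proof -
  let ?m = "monom 1 n - 1 :: 'a poly"
  note deg = degree_x_pow_minus_1[OF assms(1), where 'a = 'a]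
  have g: "g dvd ?m" and h: "h dvd ?m"
    and D: "D = {c \<in> words UNIV n. g dvd word_poly n c}"
           "D = {c \<in> words UNIV n. h dvd word_poly n c}"
    using assms(2,3) by (simp_all add: generating_divisor_UNIV)
  \<comment> \<open>For the zero code \<open>h\<close> has degree n and is not the polynomial of a
    word; its remainder always is, and \<open>g\<close> divides \<open>?m\<close>, so nothing is
    lost by reducing.\<close>
  have "coeff (h mod ?m) \<in> D"
    using coeff_mod_in_words[OF deg assms(1)] h
    by (simp add: D(2) word_poly_coeff_mod[OF deg assms(1)] dvd_mod)
  then have "g dvd h mod ?m"
    by (simp add: D(1) word_poly_coeff_mod[OF deg assms(1)])
  then show ?thesis
    using g by (simp add: dvd_mod_iff)
qed

lemma generating_divisor_associated:
  fixes g h :: "'a::field poly"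
  assumes "n \<ge> 1" "generating_divisor UNIV n D g" "generating_divisor UNIV n D h"
  obtains c where "c \<noteq> 0" "h = smult c g"
proof -
  have "g dvd h" "h dvd g"
    using generating_divisor_dvd assms by blast+
  \<comment> \<open>The alternative results from cancelling \<open>g\<close> in
    \<open>q * g dvd 1 * g\<close>.\<close>
  then obtain q where q: "h = q * g" and "q dvd 1 \<or> g = 0"
    by (metis dvdE dvd_times_right_cancel_iff mult.commute mult_1)
  show ?thesis
  proof (cases "g = 0")
    case True
    then show ?thesis using that[of 1] q by simp
  next
    case False
    then have "q dvd 1" using \<open>q dvd 1 \<or> g = 0\<close> by simp
    then obtain c where "q = [:c:]" "c dvd 1"
      by (auto simp: is_unit_poly_iff)
    then have "q = [:c:]" "c \<noteq> 0" by auto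
    then show ?thesis using that[of c] q by simp
  qed
qed

lemma generator_polynomial_unique:
  fixes g h :: "'a::field poly"
  assumes "n \<ge> 1" "generator_polynomial n D g" "generator_polynomial n D h"
  shows "g = h"
  using assms generating_divisor_associated[of n D g h]
  by (metis generator_polynomial_def lead_coeff_smult mult.right_neutral smult_1_left)

text \<open>Multiplication by x sends the last letter to x^n, while the shift puts it at position 0;
  all other letters agree.\<close>

lemma shift_word_poly:
  assumes "n \<ge> 1"
  shows "pCons 0 (word_poly n c) - word_poly n (cyclic_shift n c)
         = smult (c (n - 1)) (monom 1 n - 1)"
proof (rule poly_eqI)
  fix i
  \<comment> \<open>Only at i = 0 does the index not wrap around: there it is n - 1, the last
    letter.\<close>
  have "(i + n - 1) mod n = i - 1" if "i < n" "i > 0"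
  proof -
    have "i + n - 1 = i - 1 + n" using that by simp
    also have "\<dots> mod n = i - 1" using that by (simp del: add_diff_assoc2)
    finally show ?thesis .
  qed
  then show "coeff (pCons 0 (word_poly n c) - word_poly n (cyclic_shift n c)) i
        = coeff (smult (c (n - 1)) (monom 1 n - 1)) i"
    using assms
    by (cases "i = 0")
      (auto simp: coeff_word_poly cyclic_shift_def coeff_pCons coeff_1 not_less le_Suc_eq
        split: nat.splits)
qed

text \<open>Euclidean division by a nonzero element of least degree leaves a remainder in
  \<open>I\<close> that is too small to be nonzero. The element \<open>m\<close> guarantees a
  nonzero generator, which can then be scaled to be monic.\<close>

lemma poly_ideal_principal:
  fixes I :: "'a::field poly set"
  assumes add: "\<And>f g. f \<in> I \<Longrightarrow> g \<in> I \<Longrightarrow> f + g \<in> I"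
    and mult: "\<And>f g. f \<in> I \<Longrightarrow> g * f \<in> I"
    and "m \<in> I" "m \<noteq> 0"
  obtains g where "lead_coeff g = 1" "\<And>f. f \<in> I \<longleftrightarrow> g dvd f"
proof -
  obtain g where g: "g \<in> I" "g \<noteq> 0" and min: "\<And>f. f \<in> I \<Longrightarrow> f \<noteq> 0 \<Longrightarrow> degree g \<le> degree f"
    using ex_has_least_nat[of "\<lambda>f. f \<in> I \<and> f \<noteq> 0" m degree] assms(3,4) by auto
  have dvd: "f \<in> I \<longleftrightarrow> g dvd f" for f
  proof
    assume "f \<in> I"
    then have "f + (- (f div g)) * g \<in> I"
      using g by (intro add mult)
    then have "f mod g \<in> I"
      by (simp add: minus_div_mult_eq_mod)
    then show "g dvd f"
      using min[of "f mod g"] degree_mod_less[of g f] g by (force simp: dvd_eq_mod_eq_0)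
  next
    assume "g dvd f"
    then obtain q where "f = g * q" by (rule dvdE)
    then show "f \<in> I" using mult[OF g(1), of q] by (simp add: mult.commute)
  qed
  show ?thesis
    using that[of "smult (inverse (lead_coeff g)) g"] g dvd by (simp add: smult_dvd_iff)
qed

lemma generator_polynomial_exists:
  fixes D :: "(nat \<Rightarrow> 'a::field) set"
  assumes n: "n \<ge> 1" and D: "cyclic_code UNIV n D"
  shows "\<exists>g. generator_polynomial n D g"
proof -
  define m :: "'a poly" where "m = monom 1 n - 1"
  have deg: "degree m = n" using degree_x_pow_minus_1[OF n] by (simp add: m_def)
  \<comment> \<open>The preimage of the code in F[x]: all polynomials congruent to a codeword modulo
    x^n - 1.\<close>
  define I where "I = {f. \<exists>c\<in>D. m dvd f - word_poly n c}"
  have lin: "D \<subseteq> words UNIV n" "(\<lambda>_. 0) \<in> D"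
    "\<And>c d. c \<in> D \<Longrightarrow> d \<in> D \<Longrightarrow> (\<lambda>i. c i + d i) \<in> D"
    "\<And>a c. c \<in> D \<Longrightarrow> (\<lambda>i. a * c i) \<in> D"
    and shift: "\<And>c. c \<in> D \<Longrightarrow> cyclic_shift n c \<in> D"
    using D by (auto simp: cyclic_code_def linear_code_def)
  have add: "f + g \<in> I" if fg: "f \<in> I" "g \<in> I" for f g
  proof -
    obtain c d where cd: "c \<in> D" "d \<in> D" "m dvd f - word_poly n c" "m dvd g - word_poly n d"
      using fg unfolding I_def by blast
    have "word_poly n (\<lambda>i. c i + d i) = word_poly n c + word_poly n d"
      by (rule poly_eqI) (simp add: coeff_word_poly)
    moreover have "m dvd (f - word_poly n c) + (g - word_poly n d)"
      using cd by (intro dvd_add)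
    ultimately have "m dvd f + g - word_poly n (\<lambda>i. c i + d i)"
      by (simp add: algebra_simps)
    then show ?thesis using lin(3)[OF cd(1,2)] unfolding I_def by blast
  qed
  have smult: "smult a f \<in> I" if f: "f \<in> I" for a f
  proof -
    obtain c where c: "c \<in> D" "m dvd f - word_poly n c"
      using f unfolding I_def by blast
    have "word_poly n (\<lambda>i. a * c i) = smult a (word_poly n c)"
      by (rule poly_eqI) (simp add: coeff_word_poly)
    moreover have "m dvd smult a (f - word_poly n c)"
      using c by (intro dvd_smult)
    ultimately have "m dvd smult a f - word_poly n (\<lambda>i. a * c i)"
      by (simp add: smult_diff_right)
    then show ?thesis using lin(4)[OF c(1)] unfolding I_def by blast
  qed
  have times_x: "pCons 0 f \<in> I" if f: "f \<in> I" for f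
  proof -
    obtain c where c: "c \<in> D" "m dvd f - word_poly n c"
      using f unfolding I_def by blast
    have "m dvd [:0, 1:] * (f - word_poly n c) + smult (c (n - 1)) m"
      using c by (intro dvd_add dvd_mult dvd_smult) auto
    also have "\<dots> = pCons 0 f - word_poly n (cyclic_shift n c)"
      unfolding m_def shift_word_poly[OF n, symmetric] by simp
    finally show ?thesis using shift[OF c(1)] unfolding I_def by blast
  qed
  have zero: "0 \<in> I"
    using lin(2) by (auto simp: I_def word_poly_def intro!: bexI[of _ "\<lambda>_. 0"])
  \<comment> \<open>Horner's scheme: scalars and x generate F[x], so linearity and shift invariance
    already make \<open>I\<close> an ideal.\<close>
  have mult: "g * f \<in> I" if "f \<in> I" for f g
  proof (induction g)
    case 0
    then show ?case using zero by simp
  next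
    case (pCons a g)
    have "pCons a g * f = smult a f + pCons 0 (g * f)" by simp
    then show ?case using add smult times_x pCons that by metis
  qed
  \<comment> \<open>Congruent words are equal, since their difference has degree below that of
    \<open>m\<close>; hence passing to the preimage adds no new words.\<close>
  have I_word: "word_poly n c \<in> I \<longleftrightarrow> c \<in> D" if c: "c \<in> words UNIV n" for c
  proof
    assume "word_poly n c \<in> I"
    then obtain d where d: "d \<in> D" "m dvd word_poly n c - word_poly n d"
      by (auto simp: I_def)
    have "degree (word_poly n c - word_poly n d) < degree m"
      using degree_diff_less[OF degree_word_poly[OF n] degree_word_poly[OF n]] deg by simp
    then have "word_poly n c - word_poly n d = 0"
      using d(2) dvd_imp_degree_le linorder_not_le by blast
    then have "c = d" using word_poly_inj[of c UNIV n d] c d(1) lin(1) by auto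
    then show "c \<in> D" using d by simp
  next
    assume "c \<in> D"
    then show "word_poly n c \<in> I" unfolding I_def by (intro CollectI bexI[of _ c]) simp
  qed
  \<comment> \<open>x^n - 1 is congruent to the zero word; this is why the generator of
    \<open>I\<close> divides it.\<close>
  have mI: "m \<in> I"
    using lin(2) by (auto simp: I_def word_poly_def intro!: bexI[of _ "\<lambda>_. 0"])
  have "m \<noteq> 0" using deg n by auto
  obtain g where g: "lead_coeff g = 1" "\<And>f. f \<in> I \<longleftrightarrow> g dvd f"
    using poly_ideal_principal[of I m, OF add mult mI \<open>m \<noteq> 0\<close>] by blast
  have "D = {c \<in> words UNIV n. g dvd word_poly n c}"
    using I_word g(2) lin(1) by blast
  then show ?thesis
    using g mI by (auto simp: generator_polynomial_def generating_divisor_UNIV m_def)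
qed

text \<open>Translation by 1 permutes the ring, so the sum of all elements equals itself plus the
  cardinality.\<close>

lemma of_nat_card_eq_0: "of_nat CARD('a) = (0 :: 'a::{ring_1,finite})"
proof -
  have "(\<Sum>x\<in>UNIV. x) = (\<Sum>x\<in>UNIV. x + 1 :: 'a)"
    by (rule sum.reindex_bij_witness[of _ "\<lambda>x. x + 1" "\<lambda>x. x - 1"]) auto
  then show ?thesis by (simp add: sum.distrib)
qed

section \<open>The idempotent decomposition of \<open>R\<close>\<close>

lemma scal_0 [simp]: "scal 0 = 0"
  by transfer simp

lemma scal_1 [simp]: "scal 1 = 1"
  by transfer (simp add: one_pCons)

lemma scal_add: "scal (a + b) = scal a + scal b"
  by transfer simp

lemma scal_diff: "scal (a - b) = scal a - scal b"
  by transfer simp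

lemma scal_mult: "scal (a * b) = scal a * scal b"
  by transfer simp

lemma scal_sum: "scal (sum f A) = (\<Sum>i\<in>A. scal (f i))"
  by (induction A rule: infinite_finite_induct) (simp_all add: scal_add)

lemma scal_of_nat: "scal (of_nat n) = of_nat n"
  by (induction n) (simp_all add: scal_add)

lemma vR_power: "(vR :: ('a::field, 'r) Rr) ^ m = abs_Rr (monom 1 m)"
proof (induction m)
  case 0
  then show ?case by (simp add: one_Rr_def monom_0 one_pCons)
next
  case (Suc m)
  then show ?case by (simp add: vR_def times_Rr.abs_eq monom_Suc)
qed

lemma vR_pow_card: "(vR :: ('a::field, 'r) Rr) ^ Suc CARD('r) = vR"
proof -
  have "vR ^ Suc CARD('r) = (vR :: ('a, 'r) Rr) ^ 1"
    unfolding vR_power Rr.abs_eq_iff by (simp add: Rr_modulus_def)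
  then show ?thesis by simp
qed

lemma degree_Rr_modulus:
  assumes "r \<ge> 1"
  shows "degree (Rr_modulus r :: 'a::field poly) = r + 1"
proof (rule antisym)
  show "degree (Rr_modulus r :: 'a poly) \<le> r + 1"
    unfolding Rr_modulus_def by (rule degree_le) auto
  show "r + 1 \<le> degree (Rr_modulus r :: 'a poly)"
    unfolding Rr_modulus_def using assms by (intro le_degree) auto
qed

text \<open>Linear independence of 1, v, ..., v^r: a nonzero multiple of the modulus has degree at
  least r + 1.\<close>

lemma abs_Rr_eq_0D:
  assumes "abs_Rr P = (0 :: ('a::field, 'r::finite) Rr)" "degree P \<le> CARD('r)"
  shows "P = 0"
proof (rule ccontr)
  assume "P \<noteq> 0"
  have "Rr_modulus CARD('r) dvd P"
    using assms(1) by (simp add: zero_Rr_def Rr.abs_eq_iff)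
  then have "degree (Rr_modulus CARD('r) :: 'a poly) \<le> degree P"
    using \<open>P \<noteq> 0\<close> by (rule dvd_imp_degree_le)
  then show False
    using assms(2) degree_Rr_modulus[of "CARD('r)", where 'a = 'a] by (simp add: Suc_leI)
qed

text \<open>The coordinate map from F^3 onto \<open>R\<close>. Words and polynomials over
  \<open>R\<close> are handled through it entry by entry and coefficient by coefficient.\<close>

definition comb :: "'a::field \<Rightarrow> 'a \<Rightarrow> 'a \<Rightarrow> ('a, 'r) Rr" where
  "comb a b c = e1 * scal a + e2 * scal b + e3 * scal c"

definition comb_poly :: "'a::field poly \<Rightarrow> 'a poly \<Rightarrow> 'a poly \<Rightarrow> ('a, 'r) Rr poly" where
  "comb_poly f g h = smult e1 (lift_poly f) + smult e2 (lift_poly g) + smult e3 (lift_poly h)"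

lemma R_eq_range_comb: "x \<in> R \<longleftrightarrow> (\<exists>a b c. x = comb a b c)"
  by (simp add: R_def comb_def)

lemma comb_in_R [simp]: "comb a b c \<in> R"
  by (auto simp: R_eq_range_comb)

lemma combine_words_comb: "combine_words s t u i = comb (s i) (t i) (u i)"
  by (simp add: combine_words_def comb_def)

lemma comb_0 [simp]: "comb 0 0 0 = 0"
  by (simp add: comb_def)

lemma comb_add: "comb a b c + comb a' b' c' = comb (a + a') (b + b') (c + c')"
  by (simp add: comb_def scal_add algebra_simps)

lemma comb_diff: "comb a b c - comb a' b' c' = comb (a - a') (b - b') (c - c')"
  by (simp add: comb_def scal_diff algebra_simps)

lemma comb_sum:
  "(\<Sum>i\<in>A. comb (f i) (g i) (h i)) = comb (sum f A) (sum g A) (sum h A)"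
  by (simp add: comb_def scal_sum sum.distrib sum_distrib_left)

lemma coeff_comb_poly: "coeff (comb_poly f g h) i = comb (coeff f i) (coeff g i) (coeff h i)"
  by (simp add: comb_poly_def comb_def coeff_map_poly)

lemma comb_poly_add:
  "comb_poly f g h + comb_poly f' g' h' = comb_poly (f + f') (g + g') (h + h')"
  by (rule poly_eqI) (simp add: coeff_comb_poly comb_add)

lemma comb_poly_in_polys_over: "comb_poly f g h \<in> polys_over R"
  by (auto simp: polys_over_def coeff_comb_poly R_eq_range_comb)

lemma polys_over_R_cases:
  fixes q :: "('a::field, 'r) Rr poly"
  assumes "q \<in> polys_over R"
  obtains f g h where "q = comb_poly f g h"
proof -
  have "\<forall>i. \<exists>x. coeff q i = comb (fst x) (fst (snd x)) (snd (snd x))"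
    using assms by (simp add: polys_over_def R_eq_range_comb)
  then obtain F where F: "\<And>i. coeff q i = comb (fst (F i)) (fst (snd (F i))) (snd (snd (F i)))"
    by metis
  let ?p = "\<lambda>\<pi>. \<Sum>i\<le>degree q. monom (\<pi> (F i)) i"
  have "q = comb_poly (?p fst) (?p (\<lambda>x. fst (snd x))) (?p (\<lambda>x. snd (snd x)))"
    by (rule poly_eqI) (simp add: coeff_comb_poly coeff_sum F[symmetric] coeff_eq_0)
  then show ?thesis by (rule that)
qed

lemma word_poly_combine_words:
  "word_poly n (combine_words s t u) = comb_poly (word_poly n s) (word_poly n t) (word_poly n u)"
  by (rule poly_eqI) (simp add: coeff_word_poly coeff_comb_poly combine_words_comb)

lemma words_R_cases:
  fixes c :: "nat \<Rightarrow> ('a::field, 'r) Rr"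
  assumes "c \<in> words R n"
  obtains s t u where "s \<in> words UNIV n" "t \<in> words UNIV n" "u \<in> words UNIV n"
    "c = combine_words s t u"
proof -
  \<comment> \<open>The choice is forced to be zero from index n on, so that the three components
    are again words.\<close>
  have "\<forall>i. \<exists>x. c i = comb (fst x) (fst (snd x)) (snd (snd x)) \<and> (i \<ge> n \<longrightarrow> x = (0, 0, 0))"
  proof
    fix i
    show "\<exists>x. c i = comb (fst x) (fst (snd x)) (snd (snd x)) \<and> (i \<ge> n \<longrightarrow> x = (0, 0, 0))"
      using assms by (cases "i < n") (auto simp: words_def R_eq_range_comb)
  qed
  then obtain F where F: "\<And>i. c i = comb (fst (F i)) (fst (snd (F i))) (snd (snd (F i)))"
    and F0: "\<And>i. i \<ge> n \<Longrightarrow> F i = (0, 0, 0)"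
    by metis
  show ?thesis
    by (rule that[of "\<lambda>i. fst (F i)" "\<lambda>i. fst (snd (F i))" "\<lambda>i. snd (snd (F i))"])
      (auto simp: words_def F0 combine_words_comb F)
qed

lemma combine_words_in_words:
  "s \<in> words UNIV n \<Longrightarrow> t \<in> words UNIV n \<Longrightarrow> u \<in> words UNIV n \<Longrightarrow> combine_words s t u \<in> words R n"
  by (auto simp: words_def combine_words_comb R_eq_range_comb)

lemma cyclic_shift_combine_words:
  "cyclic_shift n (combine_words s t u)
   = combine_words (cyclic_shift n s) (cyclic_shift n t) (cyclic_shift n u)"
  by (rule ext) (simp add: cyclic_shift_def combine_words_comb)

lemma cyclic_shift_in_words: "cyclic_shift n s \<in> words UNIV n"
  by (simp add: words_def cyclic_shift_def)

section \<open>Idempotent relations and injectivity of the coordinates\<close>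

locale invertible_r =
  fixes T :: "('a::field, 'r::finite) Rr itself"
  assumes r_gt_1: "CARD('r) > 1" and r_nonzero: "(of_nat CARD('r) :: 'a) \<noteq> 0"
begin

text \<open>Since v^(r+1) = v, multiplication by v permutes the summands v, ..., v^r
  cyclically.\<close>

lemma vR_e1: "vR * e1 = (e1 :: ('a, 'r) Rr)"
proof -
  let ?v = "vR :: ('a, 'r) Rr"
  have "?v * (\<Sum>i = 1..CARD('r). ?v ^ i) = (\<Sum>i = 1..CARD('r). ?v ^ Suc i)"
    by (simp add: sum_distrib_left)
  also have "\<dots> = (\<Sum>i = 2..Suc CARD('r). ?v ^ i)"
    by (subst sum.shift_bounds_cl_Suc_ivl[symmetric]) (simp add: numeral_2_eq_2)
  also have "\<dots> = (\<Sum>i = 2..CARD('r). ?v ^ i) + ?v ^ Suc CARD('r)"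
    using r_gt_1 by simp
  also have "\<dots> = (\<Sum>i = 1..CARD('r). ?v ^ i)"
    using r_gt_1 sum.atLeast_Suc_atMost[of 1 "CARD('r)" "\<lambda>i. ?v ^ i"]
    by (simp only: vR_pow_card) (simp add: numeral_2_eq_2 add.commute)
  finally show ?thesis
    unfolding e1_def by (metis mult.left_commute)
qed

lemma vR_pow_e1: "vR ^ i * e1 = (e1 :: ('a, 'r) Rr)"
  by (induction i) (simp_all add: vR_e1 mult.assoc)

lemma scal_r_inverse: "scal (1 / of_nat CARD('r)) * of_nat CARD('r) = (1 :: ('a, 'r) Rr)"
  by (simp flip: scal_of_nat scal_mult add: r_nonzero)

lemma e1_idem: "e1 * e1 = (e1 :: ('a, 'r) Rr)"
proof -
  have "e1 * e1 = scal (1 / of_nat CARD('r)) * (\<Sum>i = 1..CARD('r). vR ^ i * (e1 :: ('a, 'r) Rr))"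
    by (subst (1) e1_def) (simp add: sum_distrib_right mult.assoc)
  \<comment> \<open>Each of the r summands equals \<open>e1\<close>, and the factor 1/r compensates
    for their number.\<close>
  also have "\<dots> = (scal (1 / of_nat CARD('r)) * of_nat CARD('r)) * e1"
    by (simp add: vR_pow_e1)
  finally show ?thesis by (simp add: scal_r_inverse)
qed

lemma e3_e1: "e3 * e1 = (0 :: ('a, 'r) Rr)"
  by (simp add: e3_def left_diff_distrib vR_pow_e1)

text \<open>v annihilates \<open>e3\<close>, so 1 - v^r acts on it as the identity.\<close>

lemma e3_idem: "e3 * e3 = (e3 :: ('a, 'r) Rr)"
proof -
  have "vR * e3 = (vR :: ('a, 'r) Rr) - vR ^ Suc CARD('r)"
    by (simp add: e3_def algebra_simps)
  then have "vR * (e3 :: ('a, 'r) Rr) = 0"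
    by (simp only: vR_pow_card) simp
  then have "vR ^ CARD('r) * (e3 :: ('a, 'r) Rr) = 0"
    using r_gt_1 by (cases "CARD('r)") (simp_all add: mult.commute[of vR] mult.assoc)
  then show ?thesis by (subst (1) e3_def) (simp add: left_diff_distrib)
qed

text \<open>The part that \<open>e1\<close> and \<open>e2\<close> share with opposite signs; it
  cancels in their sum, which is v^r.\<close>

abbreviation (input) S :: "('a, 'r) Rr" where
  "S \<equiv> \<Sum>i = 1..CARD('r) - 1. vR ^ i"

lemma e1_eq: "e1 = scal (1 / of_nat CARD('r)) * (S + vR ^ CARD('r))"
proof -
  obtain m where "CARD('r) = Suc m" using r_gt_1 by (cases "CARD('r)") auto
  then show ?thesis by (simp add: e1_def)
qed

lemma scal_r_sum:
  "scal (1 / of_nat CARD('r)) + scal (of_nat (CARD('r) - 1) / of_nat CARD('r)) = (1 :: ('a, 'r) Rr)"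
  using r_gt_1 r_nonzero
  by (simp flip: scal_add add_divide_distrib add: of_nat_diff)

lemma idem_sum: "e1 + e2 + e3 = (1 :: ('a, 'r) Rr)"
proof -
  have "e1 + e2 + e3 =
    (scal (1 / of_nat CARD('r)) + scal (of_nat (CARD('r) - 1) / of_nat CARD('r))) * vR ^ CARD('r)
    + 1 - (vR :: ('a, 'r) Rr) ^ CARD('r)"
    unfolding e1_eq e2_def e3_def by (simp add: algebra_simps)
  then show ?thesis unfolding scal_r_sum by simp
qed

text \<open>Reduces every product involving \<open>e2\<close> to the relations for \<open>e1\<close>
  and \<open>e3\<close>.\<close>

lemma e2_eq: "e2 = 1 - e1 - (e3 :: ('a, 'r) Rr)"
  using idem_sum by (simp add: algebra_simps)

lemma comb_mult:
  "comb a b c * comb a' b' c' = (comb (a * a') (b * b') (c * c') :: ('a, 'r) Rr)"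
proof -
  have orth: "e1 * e3 = (0 :: ('a, 'r) Rr)" "e1 * e2 = (0 :: ('a, 'r) Rr)"
    "e2 * e1 = (0 :: ('a, 'r) Rr)" "e2 * e3 = (0 :: ('a, 'r) Rr)" "e3 * e2 = (0 :: ('a, 'r) Rr)"
    and idem: "e2 * e2 = (e2 :: ('a, 'r) Rr)"
    using e3_e1 by (simp_all add: e2_eq algebra_simps e1_idem e3_idem)
  have *: "e * x * (f * y) = e * f * (x * y)" for e f x y :: "('a, 'r) Rr"
    by (simp add: mult_ac)
  show ?thesis
    by (simp add: comb_def distrib_left distrib_right * orth idem e1_idem e3_idem e3_e1 scal_mult)
qed

lemma comb_same: "comb a a a = (scal a :: ('a, 'r) Rr)"
  by (simp add: comb_def idem_sum flip: distrib_right)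

text \<open>Sorting by powers of v gives the shape of \<open>combined_poly\<close>, and also the
  coefficients to compare for injectivity.\<close>

lemma comb_expand:
  "comb a b c =
     scal (1 / of_nat CARD('r)) * (S * (scal a - scal b))
     + vR ^ CARD('r) * (scal (1 / of_nat CARD('r)) * scal a
          + scal (of_nat (CARD('r) - 1) / of_nat CARD('r)) * scal b - scal c) + scal c"
  unfolding comb_def e1_eq e2_def e3_def by (simp add: algebra_simps)

lemma combined_poly_eq: "combined_poly g1 g2 g3 = (comb_poly g1 g2 g3 :: ('a, 'r) Rr poly)"
  by (rule poly_eqI)
    (simp add: combined_poly_def coeff_comb_poly comb_expand coeff_map_poly coeff_sum
      sum_distrib_right)

text \<open>The expansion in 1, v, ..., v^r has only zero coefficients. The constant one gives c =
  0, that of v gives a = b, and that of v^r then reads a/r + (r-1)a/r = a.\<close>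

lemma comb_eq_0D:
  assumes "comb a b c = (0 :: ('a, 'r) Rr)"
  shows "a = 0 \<and> b = 0 \<and> c = 0"
proof -
  let ?r = "of_nat CARD('r) :: 'a"
  define P :: "'a poly" where "P = (\<Sum>i = 1..CARD('r) - 1. monom ((a - b) / ?r) i)
    + monom (a / ?r + of_nat (CARD('r) - 1) / ?r * b - c) CARD('r) + [:c:]"
  have scal_vR: "scal x * vR ^ i = (abs_Rr (monom x i) :: ('a, 'r) Rr)" for x i
    by (simp add: scal_def vR_power times_Rr.abs_eq smult_monom)
  have abs_add: "abs_Rr p + abs_Rr q = (abs_Rr (p + q) :: ('a, 'r) Rr)" for p q
    by (rule plus_Rr.abs_eq)
  have abs_sum: "(\<Sum>i\<in>A. abs_Rr (p i)) = (abs_Rr (sum p A) :: ('a, 'r) Rr)" for p and A :: "nat set"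
    by (induction A rule: infinite_finite_induct) (simp_all add: abs_add zero_Rr_def)
  have "comb a b c = (\<Sum>i = 1..CARD('r) - 1. scal ((a - b) / ?r) * vR ^ i)
    + scal (a / ?r + of_nat (CARD('r) - 1) / ?r * b - c) * (vR :: ('a, 'r) Rr) ^ CARD('r) + scal c"
    unfolding comb_expand sum_distrib_left[symmetric]
    by (simp add: mult_ac flip: scal_mult scal_diff scal_add mult.assoc)
  also have "\<dots> = abs_Rr P"
    unfolding scal_vR abs_sum abs_add P_def by (simp add: scal_def abs_add)
  finally have "abs_Rr P = (0 :: ('a, 'r) Rr)" using assms by simp
  moreover have "degree P \<le> CARD('r)"
    unfolding P_def by (rule degree_le) (auto simp: coeff_sum coeff_pCons split: nat.splits)
  ultimately have "P = 0" by (rule abs_Rr_eq_0D)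
  have c: "c = 0"
    using arg_cong[OF \<open>P = 0\<close>, of "\<lambda>p. coeff p 0"] r_gt_1 by (simp add: P_def coeff_sum)
  \<comment> \<open>As r > 1, the exponent 1 lies in the range of the sum and differs from
    r.\<close>
  have ab: "a = b"
    using arg_cong[OF \<open>P = 0\<close>, of "\<lambda>p. coeff p 1"] r_gt_1 r_nonzero Suc_le_eq[of 0 "CARD('r) - 1"]
    by (simp add: P_def coeff_sum)
  then show ?thesis
    using assms comb_same[of a] c
    using arg_cong[OF \<open>P = 0\<close>, of "\<lambda>p. coeff p CARD('r)"] r_gt_1 r_nonzero
    by (simp add: P_def coeff_sum coeff_pCons of_nat_diff field_simps split: nat.splits)
qed

lemma comb_eq_iff:
  "comb a b c = (comb a' b' c' :: ('a, 'r) Rr) \<longleftrightarrow> a = a' \<and> b = b' \<and> c = c'"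
  using comb_eq_0D[of "a - a'" "b - b'" "c - c'"] by (auto simp flip: comb_diff)

lemma comb_poly_eq_iff:
  "comb_poly f g h = (comb_poly f' g' h' :: ('a, 'r) Rr poly) \<longleftrightarrow> f = f' \<and> g = g' \<and> h = h'"
  by (auto simp: poly_eq_iff coeff_comb_poly comb_eq_iff)

lemma combine_words_eq_iff:
  "combine_words s t u = (combine_words s' t' u' :: nat \<Rightarrow> ('a, 'r) Rr)
    \<longleftrightarrow> s = s' \<and> t = t' \<and> u = u'"
  by (auto simp: fun_eq_iff combine_words_comb comb_eq_iff)

lemma comb_poly_mult:
  "comb_poly f g h * comb_poly f' g' h' = (comb_poly (f * f') (g * g') (h * h') :: ('a, 'r) Rr poly)"
  by (rule poly_eqI) (simp add: coeff_comb_poly coeff_mult comb_mult comb_sum)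

lemma comb_poly_same: "comb_poly g g g = (lift_poly g :: ('a, 'r) Rr poly)"
  by (rule poly_eqI) (simp add: coeff_comb_poly comb_same coeff_map_poly)

lemma smult_comb_poly:
  "smult (comb a b c) (comb_poly f g h)
   = (comb_poly (smult a f) (smult b g) (smult c h) :: ('a, 'r) Rr poly)"
  by (rule poly_eqI) (simp add: coeff_comb_poly comb_mult)

lemma x_pow_minus_1_eq_comb_poly:
  "monom 1 n - 1
   = (comb_poly (monom 1 n - 1) (monom 1 n - 1) (monom 1 n - 1) :: ('a, 'r) Rr poly)"
  unfolding comb_poly_same
  by (rule poly_eqI) (simp add: coeff_map_poly scal_diff coeff_1)

section \<open>Transfer of codes along the decomposition\<close>

text \<open>Membership in the three component codes is witnessed by three unrelated codewords.
  Multiplying them by \<open>e1\<close>, \<open>e2\<close>, \<open>e3\<close> (the triples 1 0 0, 0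
  1 0 and 0 0 1) erases the foreign components, and the sum is the desired word.\<close>

lemma code_decomp:
  fixes C :: "(nat \<Rightarrow> ('a, 'r) Rr) set"
  assumes "linear_code R n C" "s \<in> words UNIV n" "t \<in> words UNIV n" "u \<in> words UNIV n"
  shows "combine_words s t u \<in> C \<longleftrightarrow> s \<in> code1 n C \<and> t \<in> code2 n C \<and> u \<in> code3 n C"
proof
  assume "combine_words s t u \<in> C"
  then show "s \<in> code1 n C \<and> t \<in> code2 n C \<and> u \<in> code3 n C"
    using assms by (auto simp: code1_def code2_def code3_def)
next
  assume "s \<in> code1 n C \<and> t \<in> code2 n C \<and> u \<in> code3 n C"
  then obtain t1 u1 s2 u2 s3 t3 where C: "combine_words s t1 u1 \<in> C" "combine_words s2 t u2 \<in> C"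
    "combine_words s3 t3 u \<in> C"
    by (auto simp: code1_def code2_def code3_def)
  have add: "c \<in> C \<Longrightarrow> d \<in> C \<Longrightarrow> (\<lambda>i. c i + d i) \<in> C" for c d
    using assms(1) by (auto simp: linear_code_def)
  have mult: "c \<in> C \<Longrightarrow> (\<lambda>i. comb x y z * c i) \<in> C" for c x y z
    using assms(1) by (auto simp: linear_code_def)
  have "(\<lambda>i. comb 1 0 0 * combine_words s t1 u1 i + comb 0 1 0 * combine_words s2 t u2 i
      + comb 0 0 1 * combine_words s3 t3 u i) \<in> C"
    by (intro add mult C)
  then show "combine_words s t u \<in> C"
    by (simp add: combine_words_comb comb_mult comb_add combine_words_def flip: comb_def)
qed

lemma code_cases:
  fixes C :: "(nat \<Rightarrow> ('a, 'r) Rr) set"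
  assumes "linear_code R n C" "c \<in> C"
  obtains s t u where "s \<in> code1 n C" "t \<in> code2 n C" "u \<in> code3 n C" "c = combine_words s t u"
proof -
  have "c \<in> words R n" using assms by (auto simp: linear_code_def)
  then obtain s t u where "s \<in> words UNIV n" "t \<in> words UNIV n" "u \<in> words UNIV n"
    "c = combine_words s t u" by (rule words_R_cases)
  then show ?thesis using that assms code_decomp by blast
qed

definition combine_codes ::
    "(nat \<Rightarrow> 'a) set \<Rightarrow> (nat \<Rightarrow> 'a) set \<Rightarrow> (nat \<Rightarrow> 'a) set \<Rightarrow> (nat \<Rightarrow> ('a, 'r) Rr) set" where
  "combine_codes A B D = {combine_words s t u | s t u. s \<in> A \<and> t \<in> B \<and> u \<in> D}"

text \<open>A product of sets determines its factors only when none of them is empty.\<close>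

lemma combine_codes_eq_iff:
  assumes "A \<noteq> {}" "B \<noteq> {}" "D \<noteq> {}" "A' \<noteq> {}" "B' \<noteq> {}" "D' \<noteq> {}"
  shows "combine_codes A B D = combine_codes A' B' D' \<longleftrightarrow> A = A' \<and> B = B' \<and> D = D'"
proof -
  have mem: "combine_words s t u \<in> combine_codes X Y Z \<longleftrightarrow> s \<in> X \<and> t \<in> Y \<and> u \<in> Z"
    for s t u X Y Z
    by (auto simp: combine_codes_def combine_words_eq_iff)
  show ?thesis
  proof
    assume "combine_codes A B D = combine_codes A' B' D'"
    then have "s \<in> A \<and> t \<in> B \<and> u \<in> D \<longleftrightarrow> s \<in> A' \<and> t \<in> B' \<and> u \<in> D'" for s t u
      using mem by metis
    then have "A \<times> B \<times> D = A' \<times> B' \<times> D'" by auto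
    then show "A = A' \<and> B = B' \<and> D = D'" using assms by (auto simp: times_eq_iff)
  qed simp
qed

lemma combine_codes_decomp:
  assumes "linear_code R n (C :: (nat \<Rightarrow> ('a, 'r) Rr) set)"
  shows "C = combine_codes (code1 n C) (code2 n C) (code3 n C)"
proof (intro set_eqI iffI)
  fix c assume "c \<in> C"
  then show "c \<in> combine_codes (code1 n C) (code2 n C) (code3 n C)"
    using code_cases[OF assms] unfolding combine_codes_def by blast
next
  fix c assume "c \<in> combine_codes (code1 n C) (code2 n C) (code3 n C)"
  then obtain s t u where *: "s \<in> code1 n C" "t \<in> code2 n C" "u \<in> code3 n C"
    and c: "c = combine_words s t u"
    by (auto simp: combine_codes_def)
  then have "s \<in> words UNIV n" "t \<in> words UNIV n" "u \<in> words UNIV n"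
    by (auto simp: code1_def code2_def code3_def)
  then show "c \<in> C" using * c code_decomp[OF assms] by blast
qed

text \<open>The multipliers in R[x] are themselves triples, so one membership equation amounts to
  three independent ones over F.\<close>

lemma generated_code_comb_poly:
  "generated_code R n (comb_poly f g h :: ('a, 'r) Rr poly)
   = combine_codes (generated_code UNIV n f) (generated_code UNIV n g) (generated_code UNIV n h)"
proof -
  have *: "combine_words s t u \<in> generated_code R n (comb_poly f g h :: ('a, 'r) Rr poly) \<longleftrightarrow>
      s \<in> generated_code UNIV n f \<and> t \<in> generated_code UNIV n g \<and> u \<in> generated_code UNIV n h"
    if w: "s \<in> words UNIV n" "t \<in> words UNIV n" "u \<in> words UNIV n" for s t u
  proof
    let ?m = "monom 1 n - 1 :: ('a, 'r) Rr poly"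
    assume "combine_words s t u \<in> generated_code R n (comb_poly f g h :: ('a, 'r) Rr poly)"
    then obtain p q where pq: "p \<in> polys_over R" "q \<in> polys_over R"
      "word_poly n (combine_words s t u) = p * comb_poly f g h + q * ?m"
      by (auto simp: generated_code_def)
    from pq(1) obtain p1 p2 p3 where p: "p = comb_poly p1 p2 p3" by (rule polys_over_R_cases)
    from pq(2) obtain q1 q2 q3 where q: "q = comb_poly q1 q2 q3" by (rule polys_over_R_cases)
    have "word_poly n s = p1 * f + q1 * (monom 1 n - 1) \<and>
          word_poly n t = p2 * g + q2 * (monom 1 n - 1) \<and>
          word_poly n u = p3 * h + q3 * (monom 1 n - 1)"
      using pq(3) unfolding p q x_pow_minus_1_eq_comb_poly word_poly_combine_words
        comb_poly_mult comb_poly_add comb_poly_eq_iff .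
    then show "s \<in> generated_code UNIV n f \<and> t \<in> generated_code UNIV n g \<and>
        u \<in> generated_code UNIV n h"
      using w by (auto simp: generated_code_def)
  next
    assume "s \<in> generated_code UNIV n f \<and> t \<in> generated_code UNIV n g \<and>
        u \<in> generated_code UNIV n h"
    then obtain p1 p2 p3 q1 q2 q3 where
      "word_poly n s = p1 * f + q1 * (monom 1 n - 1)"
      "word_poly n t = p2 * g + q2 * (monom 1 n - 1)"
      "word_poly n u = p3 * h + q3 * (monom 1 n - 1)"
      by (auto simp: generated_code_def)
    then have "word_poly n (combine_words s t u) =
      comb_poly p1 p2 p3 * comb_poly f g h
      + comb_poly q1 q2 q3 * (monom 1 n - 1 :: ('a, 'r) Rr poly)"
      unfolding x_pow_minus_1_eq_comb_poly word_poly_combine_words comb_poly_mult comb_poly_add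
      by simp
    then show "combine_words s t u \<in> generated_code R n (comb_poly f g h :: ('a, 'r) Rr poly)"
      using combine_words_in_words[OF w] comb_poly_in_polys_over
      unfolding generated_code_def by blast
  qed
  show ?thesis
  proof (intro set_eqI iffI)
    fix c assume c: "c \<in> generated_code R n (comb_poly f g h :: ('a, 'r) Rr poly)"
    then have "c \<in> words R n" by (simp add: generated_code_def)
    then obtain s t u where "s \<in> words UNIV n" "t \<in> words UNIV n" "u \<in> words UNIV n"
      "c = combine_words s t u" by (rule words_R_cases)
    then show "c \<in> combine_codes (generated_code UNIV n f) (generated_code UNIV n g)
        (generated_code UNIV n h)"
      using c * unfolding combine_codes_def by blast
  next
    fix c assume "c \<in> combine_codes (generated_code UNIV n f) (generated_code UNIV n g)
        (generated_code UNIV n h)"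
    then obtain s t u where "s \<in> generated_code UNIV n f" "t \<in> generated_code UNIV n g"
      "u \<in> generated_code UNIV n h" "c = combine_words s t u"
      unfolding combine_codes_def by blast
    moreover from this have "s \<in> words UNIV n" "t \<in> words UNIV n" "u \<in> words UNIV n"
      by (simp_all add: generated_code_def)
    ultimately show "c \<in> generated_code R n (comb_poly f g h :: ('a, 'r) Rr poly)"
      using * by blast
  qed
qed

lemma zero_in_generated_code: "(\<lambda>_. 0) \<in> generated_code UNIV n g"
proof -
  have "word_poly n (\<lambda>_. 0) = 0 * g + 0 * (monom 1 n - 1)"
    by (simp add: word_poly_def)
  moreover have "(\<lambda>_. 0) \<in> words UNIV n"
    by (simp add: words_def)
  ultimately show ?thesis unfolding generated_code_def polys_over_UNIV by blast
qed

text \<open>The cofactor splits as well, so divisibility is componentwise. Read from right to left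
  this yields existence; read from left to right it yields the comparison of arbitrary generating
  divisors.\<close>

lemma generating_divisor_comb_poly:
  fixes C :: "(nat \<Rightarrow> ('a, 'r) Rr) set"
  assumes "linear_code R n C"
  shows "generating_divisor R n C (comb_poly f g h) \<longleftrightarrow>
    generating_divisor UNIV n (code1 n C) f \<and> generating_divisor UNIV n (code2 n C) g \<and>
    generating_divisor UNIV n (code3 n C) h"
proof -
  have "(\<lambda>_. 0) \<in> C" using assms by (simp add: linear_code_def)
  then obtain s t u where "s \<in> code1 n C" "t \<in> code2 n C" "u \<in> code3 n C"
    using code_cases[OF assms] by blast
  then have ne: "code1 n C \<noteq> {}" "code2 n C \<noteq> {}" "code3 n C \<noteq> {}" by auto
  have ne': "generated_code UNIV n q \<noteq> {}" for q :: "'b::comm_ring_1 poly"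
    using zero_in_generated_code by auto
  have code: "C = generated_code R n (comb_poly f g h) \<longleftrightarrow>
      code1 n C = generated_code UNIV n f \<and> code2 n C = generated_code UNIV n g \<and>
      code3 n C = generated_code UNIV n h"
    unfolding generated_code_comb_poly
    by (subst combine_codes_decomp[OF assms]) (rule combine_codes_eq_iff[OF ne ne' ne' ne'])
  have "(\<exists>q\<in>polys_over R. monom 1 n - 1 = (comb_poly f g h :: ('a, 'r) Rr poly) * q) \<longleftrightarrow>
      (\<exists>q1 q2 q3. monom 1 n - 1 = (comb_poly f g h :: ('a, 'r) Rr poly) * comb_poly q1 q2 q3)"
    using comb_poly_in_polys_over by (metis polys_over_R_cases)
  also have "\<dots> \<longleftrightarrow> (\<exists>q. monom 1 n - 1 = f * q) \<and> (\<exists>q. monom 1 n - 1 = g * q) \<and>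
      (\<exists>q. monom 1 n - 1 = h * q)"
    unfolding x_pow_minus_1_eq_comb_poly comb_poly_mult comb_poly_eq_iff by auto
  finally show ?thesis
    unfolding generating_divisor_def using code by (auto simp: comb_poly_in_polys_over)
qed

lemma cyclic_components:
  fixes C :: "(nat \<Rightarrow> ('a, 'r) Rr) set"
  assumes "cyclic_code R n C"
  shows "cyclic_code UNIV n (code1 n C)" "cyclic_code UNIV n (code2 n C)"
    "cyclic_code UNIV n (code3 n C)"
proof -
  have lin: "linear_code R n C" using assms by (simp add: cyclic_code_def)
  have C0: "(\<lambda>_. 0) \<in> C"
    and Cadd: "\<And>c d. c \<in> C \<Longrightarrow> d \<in> C \<Longrightarrow> (\<lambda>i. c i + d i) \<in> C"
    and Cmult: "\<And>a b d c. c \<in> C \<Longrightarrow> (\<lambda>i. comb a b d * c i) \<in> C"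
    using lin by (auto simp: linear_code_def)
  have zero: "combine_words (\<lambda>_. 0) (\<lambda>_. 0) (\<lambda>_. 0) \<in> C"
    using C0 by (simp add: combine_words_def)
  have add: "combine_words (\<lambda>i. s i + s' i) (\<lambda>i. t i + t' i) (\<lambda>i. u i + u' i) \<in> C"
    if "combine_words s t u \<in> C" "combine_words s' t' u' \<in> C" for s t u s' t' u'
  proof -
    have "combine_words (\<lambda>i. s i + s' i) (\<lambda>i. t i + t' i) (\<lambda>i. u i + u' i)
        = (\<lambda>i. combine_words s t u i + (combine_words s' t' u' i :: ('a, 'r) Rr))"
      by (rule ext) (simp add: combine_words_comb comb_add)
    then show ?thesis using Cadd[OF that] by simp
  qed
  \<comment> \<open>A scalar a of F acts on the code as the diagonal element
    \<open>comb a a a\<close> of \<open>R\<close>.\<close>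
  have mult: "combine_words (\<lambda>i. a * s i) (\<lambda>i. a * t i) (\<lambda>i. a * u i) \<in> C"
    if "combine_words s t u \<in> C" for a s t u
  proof -
    have "combine_words (\<lambda>i. a * s i) (\<lambda>i. a * t i) (\<lambda>i. a * u i)
        = (\<lambda>i. comb a a a * (combine_words s t u i :: ('a, 'r) Rr))"
      by (rule ext) (simp add: combine_words_comb comb_mult)
    then show ?thesis using Cmult[OF that] by simp
  qed
  have shift: "combine_words (cyclic_shift n s) (cyclic_shift n t) (cyclic_shift n u) \<in> C"
    if "combine_words s t u \<in> C" for s t u
    using assms that by (auto simp: cyclic_code_def simp flip: cyclic_shift_combine_words)
  have w0: "(\<lambda>_. 0) \<in> words UNIV n"
    and wadd: "\<And>s t. s \<in> words UNIV n \<Longrightarrow> t \<in> words UNIV n \<Longrightarrow> (\<lambda>i. s i + t i) \<in> words UNIV n"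
    and wmult: "\<And>a s. s \<in> words UNIV n \<Longrightarrow> (\<lambda>i. a * s i) \<in> words UNIV n"
    for n :: nat
    by (auto simp: words_def)
  note closed = w0 wadd wmult cyclic_shift_in_words zero add mult shift
  show "cyclic_code UNIV n (code1 n C)"
    unfolding cyclic_code_def linear_code_def code1_def
    by (intro conjI ballI subsetI) (auto, (blast intro: closed)+)
  show "cyclic_code UNIV n (code2 n C)"
    unfolding cyclic_code_def linear_code_def code2_def
    by (intro conjI ballI subsetI) (auto, (blast intro: closed)+)
  show "cyclic_code UNIV n (code3 n C)"
    unfolding cyclic_code_def linear_code_def code3_def
    by (intro conjI ballI subsetI) (auto, (blast intro: closed)+)
qed

end

theorem corollary3:
  fixes p k r n :: nat
    and C :: "(nat \<Rightarrow> ('a::{field,finite}, 'r::finite) Rr) set"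
  assumes "prime p" and "k \<ge> 1" and "CARD('a) = p ^ k"
    and "r > 1" and "CARD('r) = r" and "coprime r p"
    and "n \<ge> 1"
    and "cyclic_code R n C"
  shows "(\<exists>!g. generating_divisor R n C g \<and>
             (\<exists>g1 g2 g3. generator_polynomial n (code1 n C) g1 \<and>
                generator_polynomial n (code2 n C) g2 \<and>
                generator_polynomial n (code3 n C) g3 \<and>
                g = combined_poly g1 g2 g3))
       \<and> (\<forall>g1 g2 g3. generator_polynomial n (code1 n C) g1 \<and>
                generator_polynomial n (code2 n C) g2 \<and>
                generator_polynomial n (code3 n C) g3 \<longrightarrow>
             (\<forall>h. generating_divisor R n C h \<longrightarrow>
                (\<exists>u\<in>R. (\<exists>w\<in>R. u * w = 1) \<and> h = smult u (combined_poly g1 g2 g3))) \<and>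
             (g1 = g2 \<and> g2 = g3 \<longrightarrow> combined_poly g1 g2 g3 = (lift_poly g1 :: ('a, 'r) Rr poly)))"
proof -
  have "(of_nat r :: 'a) \<noteq> 0"
  proof
    assume "(of_nat r :: 'a) = 0"
    then have "CHAR('a) dvd r" by (simp add: of_nat_eq_0_iff_char_dvd)
    \<comment> \<open>The characteristic divides the order of the field; being a common divisor of r
      and p^k, it would have to be 1.\<close>
    moreover have "CHAR('a) dvd p ^ k"
      using of_nat_card_eq_0[where 'a = 'a] assms(3) by (metis of_nat_eq_0_iff_char_dvd)
    ultimately have "CHAR('a) dvd 1"
      using \<open>coprime r p\<close> by (metis coprime_common_divisor coprime_power_right_iff)
    then show False
      by (metis of_nat_1 of_nat_eq_0_iff_char_dvd zero_neq_one)
  qed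
  then interpret invertible_r "TYPE(('a, 'r) Rr)"
    using assms by unfold_locales auto
  have lin: "linear_code R n C" using \<open>cyclic_code R n C\<close> by (simp add: cyclic_code_def)
  note gd = generating_divisor_comb_poly[OF lin]
  note unique = generator_polynomial_unique[OF \<open>n \<ge> 1\<close>]
  obtain g1 g2 g3 where g: "generator_polynomial n (code1 n C) g1"
    "generator_polynomial n (code2 n C) g2" "generator_polynomial n (code3 n C) g3"
    using generator_polynomial_exists[OF \<open>n \<ge> 1\<close>] cyclic_components[OF \<open>cyclic_code R n C\<close>] by metis
  have ex1: "\<exists>!g. generating_divisor R n C g \<and>
             (\<exists>g1 g2 g3. generator_polynomial n (code1 n C) g1 \<and>
                generator_polynomial n (code2 n C) g2 \<and>
                generator_polynomial n (code3 n C) g3 \<and>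
                g = combined_poly g1 g2 g3)"
  proof (rule ex1I[of _ "combined_poly g1 g2 g3"])
    show "generating_divisor R n C (combined_poly g1 g2 g3) \<and>
             (\<exists>g1' g2' g3'. generator_polynomial n (code1 n C) g1' \<and>
                generator_polynomial n (code2 n C) g2' \<and>
                generator_polynomial n (code3 n C) g3' \<and>
                combined_poly g1 g2 g3 = (combined_poly g1' g2' g3' :: ('a, 'r) Rr poly))"
      using g by (auto simp: combined_poly_eq gd generator_polynomial_def)
  qed (use g unique in blast)
  \<comment> \<open>Each component of \<open>h\<close> differs from the monic generator by its own
    constant; the three constants are the coordinates of the unit.\<close>
  have unit: "\<exists>u\<in>R. (\<exists>w\<in>R. u * w = 1) \<and> h = smult u (combined_poly g1 g2 g3)"
    if g: "generator_polynomial n (code1 n C) g1" "generator_polynomial n (code2 n C) g2"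
      "generator_polynomial n (code3 n C) g3" and h: "generating_divisor R n C h"
    for g1 g2 g3 h
  proof -
    have "h \<in> polys_over R" using h by (simp add: generating_divisor_def)
    then obtain h1 h2 h3 where hh: "h = comb_poly h1 h2 h3" by (rule polys_over_R_cases)
    have gd_h: "generating_divisor UNIV n (code1 n C) h1" "generating_divisor UNIV n (code2 n C) h2"
      "generating_divisor UNIV n (code3 n C) h3"
      using h by (simp_all add: hh gd)
    have gd_g: "generating_divisor UNIV n (code1 n C) g1" "generating_divisor UNIV n (code2 n C) g2"
      "generating_divisor UNIV n (code3 n C) g3"
      using g by (simp_all add: generator_polynomial_def)
    note assoc = generating_divisor_associated[OF \<open>n \<ge> 1\<close>]
    obtain a where a: "a \<noteq> 0" "h1 = smult a g1"
      by (rule assoc[OF gd_g(1) gd_h(1)])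
    obtain b where b: "b \<noteq> 0" "h2 = smult b g2"
      by (rule assoc[OF gd_g(2) gd_h(2)])
    obtain c where c: "c \<noteq> 0" "h3 = smult c g3"
      by (rule assoc[OF gd_g(3) gd_h(3)])
    have "h = smult (comb a b c) (combined_poly g1 g2 g3)"
      by (simp add: hh a b c combined_poly_eq smult_comb_poly)
    \<comment> \<open>The inverse is taken coordinatewise, the unit element of \<open>R\<close>
      being \<open>comb 1 1 1\<close>.\<close>
    moreover have "comb a b c * comb (inverse a) (inverse b) (inverse c) = (1 :: ('a, 'r) Rr)"
      using a b c by (simp add: comb_mult comb_same)
    ultimately show ?thesis using R_eq_range_comb by blast
  qed
  show ?thesis
    using ex1 unit by (auto simp: combined_poly_eq comb_poly_same)
qed

end
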